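(* Let $N\ge1$ and let the standing assumptions of the context hold with constant step length $\tau_k\equiv\tau>0$ and with $1+\gamma_k\tau\ge\Lambda_k$ for all $k=0,\ldots,N-1$. Let $x^1,\ldots,x^N$ be generated from an initial $x^0\in X_0$ by $$z^{k+1}:=A_k(x^k),\qquad x^{k+1}:=\mathrm{prox}_{\tau G_{k+1}}\bigl(z^{k+1}-\tau\nabla F_{k+1}(z^{k+1})\bigr)\qquad(k\in\mathbb{N}).$$ Then, writing $J_k:=F_k+G_k$, $$\sup_{\bar x^{1:N}\in\mathcal{B}_{1:N}}\sum_{k=1}^N\bigl(J_k(x^k)-J_k(\bar x^k)\bigr)+\sum_{k=0}^{N-1}\frac{1-\zeta_{k+1}}{2\tau}\|x^{k+1}-A_k(x^k)\|^2\le\sup_{\bar x^0\in\mathcal{B}_0}\frac{\|x^0-\bar x^0\|^2}{2\tau(1+\gamma_0\tau)^{-1}}+\sum_{k=1}^N\frac{\epsilon_k}{\tau}.$$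
   Context: Notation: $x^{n:m}:=(x^n,\ldots,x^m)$; for $\mathcal{B}\subset\prod_{k=0}^\infty X_k$, $\mathcal{B}_{n:m}:=\{x^{n:m}\mid x^{0:\infty}\in\mathcal{B}\}$ and $\mathcal{B}_n:=\mathcal{B}_{n:n}$. The first term of the estimate is called the dynamic regret. $\mathrm{prox}_F(x):=\arg\min_{\tilde x}F(\tilde x)+\frac12\|\tilde x-x\|^2$. A function $F$ is (strongly) subdifferentiable with factor $\gamma\ge0$ if $F(\tilde x)-F(x)\ge\langle z,\tilde x-x\rangle+\frac{\gamma}{2}\|\tilde x-x\|^2$ for all $x$, all $z\in\partial F(x)$ and all $\tilde x$ ($\gamma=0$ being plain convexity). Standing assumptions: $X_k$ ($k\in\mathbb{N}=\{0,1,2,\ldots\}$) are Hilbert spaces. For all $k\ge1$: $F_k:X_k\to\mathbb{R}$ and $G_k:X_k\to(-\infty,\infty]$ are convex, proper, and lower semicontinuous; $\nabla F_k$ exists and is $L_k$-Lipschitz; $\gamma_{F_k},\gamma_{G_k}\ge0$ are factors of (strong) subdifferentiability of $F_k$ and $G_k$; for step length parameters $\tau_k>0$ and some $\zeta_k\in(0,1]$, $$0\le\gamma_k:=\begin{cases}\gamma_{G_k}+\gamma_{F_k}-\tau_k\zeta_k^{-1}L_k^2,&\gamma_{F_k}>0,\\ \gamma_{G_k},&\gamma_{F_k}=0,\text{ in which case we require }\tau_kL_k\le\zeta_k.\end{cases}$$ For index $0$, $\gamma_0\ge0$ is a given number and $\tau_0=\tau$. $A_k:X_k\to X_{k+1}$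 ($k\in\mathbb{N}$) are given predictors and $\mathcal{B}\subset\prod_{k=0}^\infty X_k$ is a bounded comparison set (each $\mathcal{B}_k$ is bounded) such that for the iterates $x^k$ of the algorithm, factors $\Lambda_k>0$ and prediction errors $\epsilon_{k+1}\in\mathbb{R}$, $$\tfrac12\|A_k(x^k)-\bar x^{k+1}\|^2\le\tfrac{\Lambda_k}{2}\|x^k-\bar x^k\|^2+\epsilon_{k+1}\qquad(\bar x^{0:\infty}\in\mathcal{B},\ k\in\mathbb{N}).$$ *)

theory Defs
  imports "HOL-Analysis.Analysis"
begin

text \<open>
  A Hilbert space is represented as a complete linear subspace \<open>S\<close> of an ambient real inner product
  space, so that a sequence of Hilbert spaces is a set-valued sequence. There is no loss of
  generality, since any sequence of Hilbert spaces embeds isometrically into its Hilbert direct sum.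
  Functions on \<open>S\<close> are total on the ambient type; their values outside \<open>S\<close> are irrelevant.
  Functions with values in \<open>(-\<infinity>,\<infinity>]\<close> are \<open>ereal\<close>-valued, the value \<open>-\<infinity>\<close> being
  excluded by properness.
\<close>

definition hilbert_subspace :: "'a::real_inner set \<Rightarrow> bool" where
  "hilbert_subspace S \<longleftrightarrow> subspace S \<and> complete S"

definition ereal_convex_on :: "'a::real_vector set \<Rightarrow> ('a \<Rightarrow> ereal) \<Rightarrow> bool" where
  "ereal_convex_on S f \<longleftrightarrow> convex S \<and>
     (\<forall>x\<in>S. \<forall>y\<in>S. \<forall>u\<ge>0. \<forall>v\<ge>0. u + v = 1 \<longrightarrow>
        f (u *\<^sub>R x + v *\<^sub>R y) \<le> ereal u * f x + ereal v * f y)"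

definition proper_on :: "'a set \<Rightarrow> ('a \<Rightarrow> ereal) \<Rightarrow> bool" where
  "proper_on S f \<longleftrightarrow> (\<forall>x\<in>S. f x \<noteq> -\<infinity>) \<and> (\<exists>x\<in>S. f x \<noteq> \<infinity>)"

definition lsc_on :: "'a::topological_space set \<Rightarrow> ('a \<Rightarrow> ereal) \<Rightarrow> bool" where
  "lsc_on S f \<longleftrightarrow> (\<forall>x\<in>S. f x \<le> Liminf (at x within S) f)"

text \<open>For a proper function, the subdifferential is empty at points where the value is \<open>\<infinity>\<close>.\<close>

definition subdifferential :: "'a::real_inner set \<Rightarrow> ('a \<Rightarrow> ereal) \<Rightarrow> 'a \<Rightarrow> 'a set" where
  "subdifferential S f x = {z \<in> S. \<forall>y\<in>S. f x + ereal (z \<bullet> (y - x)) \<le> f y}"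

definition subdifferentiable_with_factor ::
    "'a::real_inner set \<Rightarrow> ('a \<Rightarrow> ereal) \<Rightarrow> real \<Rightarrow> bool" where
  "subdifferentiable_with_factor S f \<gamma> \<longleftrightarrow> 0 \<le> \<gamma> \<and>
     (\<forall>x\<in>S. \<forall>z\<in>subdifferential S f x. \<forall>y\<in>S.
        f x + ereal (z \<bullet> (y - x) + \<gamma> / 2 * (norm (y - x))\<^sup>2) \<le> f y)"

text \<open>
  The gradient is that of \<open>f\<close> as a function on the Hilbert space \<open>S\<close>: the Frechet
  derivative within \<open>S\<close> together with its Riesz representative in \<open>S\<close>.
\<close>

definition has_gradient_on ::
    "('a::real_inner \<Rightarrow> real) \<Rightarrow> ('a \<Rightarrow> 'a) \<Rightarrow> 'a set \<Rightarrow> bool" where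
  "has_gradient_on f g S \<longleftrightarrow>
     (\<forall>x\<in>S. g x \<in> S \<and> (f has_derivative (\<lambda>h. g x \<bullet> h)) (at x within S))"

definition prox :: "'a::real_inner set \<Rightarrow> ('a \<Rightarrow> ereal) \<Rightarrow> 'a \<Rightarrow> 'a" where
  "prox S f x = arg_min_on (\<lambda>y. f y + ereal (1 / 2 * (norm (y - x))\<^sup>2)) S"

text \<open>
  The segments \<open>(x n, \<dots>, x m)\<close> of the members of \<open>B\<close>, as functions restricted to the index range,
  and the set of the \<open>n\<close>-th entries, where a segment of length one is identified with the single entry.
\<close>

definition segments :: "(nat \<Rightarrow> 'a) set \<Rightarrow> nat \<Rightarrow> nat \<Rightarrow> (nat \<Rightarrow> 'a) set" where
  "segments B n m = (\<lambda>x. restrict x {n..m}) ` B"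

definition entries :: "(nat \<Rightarrow> 'a) set \<Rightarrow> nat \<Rightarrow> 'a set" where
  "entries B n = (\<lambda>x. x n) ` B"

definition objective :: "('a \<Rightarrow> real) \<Rightarrow> ('a \<Rightarrow> ereal) \<Rightarrow> 'a \<Rightarrow> ereal" where
  "objective F G x = ereal (F x) + G x"

end

theory Submission
  imports Defs
begin

text \<open>
  Optimality of the proximal step gives a subgradient of \<open>G\<^sub>k\<close>; together with the descent lemma (or
  Young's inequality, when \<open>F\<^sub>k\<close> is strongly convex) and the three-point identity this bounds each gap
  \<open>J\<^sub>k(x\<^sup>k) - J\<^sub>k(u)\<close> by a difference of squared distances to \<open>u\<close>, the second one weighted by
  \<open>1 + \<gamma>\<^sub>k \<tau>\<close>. Since \<open>\<Lambda>\<^sub>k \<le> 1 + \<gamma>\<^sub>k \<tau>\<close>, prediction at most restores that weight up to the prediction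
  error, so the sum telescopes.
\<close>

section \<open>Convexity along segments and elementary inequalities\<close>

lemma ereal_convex_onD:
  assumes "ereal_convex_on S f" "x \<in> S" "y \<in> S" "0 \<le> t" "t \<le> 1"
    and "f x = ereal a" "f y = ereal b"
  shows "f (x + t *\<^sub>R (y - x)) \<le> ereal ((1 - t) * a + t * b)"
proof -
  have "f ((1 - t) *\<^sub>R x + t *\<^sub>R y) \<le> ereal (1 - t) * f x + ereal t * f y"
    using assms(1-5) unfolding ereal_convex_on_def by auto
  moreover have "(1 - t) *\<^sub>R x + t *\<^sub>R y = x + t *\<^sub>R (y - x)"
    by (simp add: algebra_simps)
  ultimately show ?thesis
    using assms(6,7) by simp
qed

lemma convex_segment_mem:
  assumes "convex S" "x \<in> S" "y \<in> S" "0 \<le> t" "t \<le> 1"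
  shows "x + t *\<^sub>R (y - x) \<in> S"
proof -
  have "(1 - t) *\<^sub>R x + t *\<^sub>R y \<in> S"
    using assms by (simp add: convex_alt)
  then show ?thesis
    by (simp add: algebra_simps)
qed

text \<open>Letting \<open>t\<close> tend to 0 gives the claim. It turns minimality tested on short
  segments into a first-order condition.\<close>

lemma nonpos_if_le_small_multiples:
  fixes a b :: real
  assumes "\<And>t. 0 < t \<Longrightarrow> t \<le> 1 \<Longrightarrow> a \<le> t * b"
  shows "a \<le> 0"
proof (rule ccontr)
  assume "\<not> a \<le> 0"
  \<comment> \<open>Chosen so that \<open>t * b\<close> is at most \<open>a / 2\<close>; the summand
    1 keeps the denominator positive when \<open>b = 0\<close>.\<close>
  define t where "t = min 1 (a / (2 * (\<bar>b\<bar> + 1)))"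
  have "0 < a / (2 * (\<bar>b\<bar> + 1))"
    using \<open>\<not> a \<le> 0\<close> by (intro divide_pos_pos) auto
  then have t: "0 < t" "t \<le> 1" "t \<le> a / (2 * (\<bar>b\<bar> + 1))"
    unfolding t_def by simp_all
  have "a \<le> t * b"
    using assms t by blast
  also have "\<dots> \<le> t * (\<bar>b\<bar> + 1)"
    using t by (intro mult_left_mono) auto
  also have "\<dots> \<le> a / (2 * (\<bar>b\<bar> + 1)) * (\<bar>b\<bar> + 1)"
    using t by (intro mult_right_mono) auto
  also have "\<dots> = a / 2"
    by (simp add: field_simps)
  finally show False
    using \<open>\<not> a \<le> 0\<close> by simp
qed

lemma norm_add_sq:
  fixes u v :: "'a::real_inner"
  shows "(norm (u + v))\<^sup>2 = (norm u)\<^sup>2 + 2 * (u \<bullet> v) + (norm v)\<^sup>2"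
  by (simp add: power2_norm_eq_inner inner_add inner_commute)

section \<open>Existence of a minimizer of the proximal objective\<close>

text \<open>The \<open>Liminf\<close> only sees punctured neighbourhoods; the assumption
  \<open>c < f x\<close> puts the centre back, so the bound holds on a full ball.\<close>

lemma lsc_onD:
  assumes "lsc_on S f" "x \<in> S" "c < f x"
  shows "\<exists>r>0. \<forall>y\<in>S. dist y x < r \<longrightarrow> c < f y"
proof -
  have "\<forall>\<^sub>F y in at x within S. c < f y"
    using assms unfolding lsc_on_def le_Liminf_iff by auto
  then obtain r where "r > 0" "\<forall>y\<in>S. y \<noteq> x \<and> dist y x < r \<longrightarrow> c < f y"
    unfolding eventually_at by auto
  then show ?thesis
    using assms(3) by metis
qed

text \<open>Lower semicontinuity bounds \<open>f\<close> below near a point, and convexity extends this to a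
  bound of linear growth; this replaces the affine minorant from the Hahn-Banach theorem.\<close>

lemma convex_lsc_linear_lower_bound:
  fixes S :: "'a::real_inner set"
  assumes conv: "ereal_convex_on S f" and lsc: "lsc_on S f"
    and y0: "y0 \<in> S" "f y0 = ereal a"
  shows "\<exists>b\<ge>0. \<forall>y\<in>S. \<forall>c. f y = ereal c \<longrightarrow> a - 1 - b * norm (y - y0) \<le> c"
proof -
  have "ereal (a - 1) < f y0"
    using y0 by simp
  then obtain r where r: "r > 0" "\<And>y. y \<in> S \<Longrightarrow> dist y y0 < r \<Longrightarrow> ereal (a - 1) < f y"
    using lsc_onD[OF lsc y0(1)] by blast
  have convS: "convex S"
    using conv by (simp add: ereal_convex_on_def)
  have "a - 1 - 2 / r * norm (y - y0) \<le> c" if y: "y \<in> S" "f y = ereal c" for y c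
  proof (cases "norm (y - y0) < r")
    case True
    then have "a - 1 < c"
      using r(2)[OF y(1)] y by (simp add: dist_norm)
    moreover have "0 \<le> 2 / r * norm (y - y0)"
      using r by simp
    ultimately show ?thesis
      by linarith
  next
    case False
    define d where "d = norm (y - y0)"
    \<comment> \<open>This \<open>t\<close> puts \<open>?v\<close> at distance \<open>r / 2\<close>
      from \<open>y0\<close>, inside the ball where \<open>f\<close> exceeds \<open>a - 1\<close>.
      Convexity then gives \<open>a - c < 1 / t\<close>, which is the linear growth with slope
      \<open>2 / r\<close>.\<close>
    define t where "t = r / (2 * d)"
    have d: "d \<ge> r" "d > 0"
      using False r by (auto simp: d_def)
    have t: "0 < t" "t \<le> 1"
      using d r by (auto simp: t_def field_simps)
    let ?v = "y0 + t *\<^sub>R (y - y0)"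
    have "?v \<in> S"
      using convex_segment_mem[OF convS y0(1) y(1)] t by simp
    moreover have "dist ?v y0 < r"
      using d r by (simp add: dist_norm t_def flip: d_def)
    ultimately have "ereal (a - 1) < f ?v"
      using r by blast
    also have "\<dots> \<le> ereal ((1 - t) * a + t * c)"
      using ereal_convex_onD[OF conv y0(1) y(1)] t y0 y by simp
    finally have "t * (a - c) < 1"
      by (simp add: algebra_simps)
    then have "a - c < 2 / r * d"
      using d r by (simp add: t_def field_simps)
    then show ?thesis
      by (simp add: d_def)
  qed
  then show ?thesis
    using r(1) by (intro exI[of _ "2 / r"]) auto
qed

text \<open>The parallelogram law for \<open>p - w\<close> and \<open>q - w\<close>, with the
  midpoint written in the form used for convexity along a segment.\<close>

lemma midpoint_norm_sq:
  fixes p q w :: "'a::real_inner"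
  shows "(norm (p + (1/2) *\<^sub>R (q - p) - w))\<^sup>2
    = 1/2 * (norm (p - w))\<^sup>2 + 1/2 * (norm (q - w))\<^sup>2 - 1/4 * (norm (p - q))\<^sup>2"
  by (simp add: power2_norm_eq_inner inner_simps algebra_simps inner_commute)

text \<open>By the parallelogram law a minimizing sequence is a Cauchy sequence.\<close>

lemma prox_objective_attains_min:
  fixes S :: "'a::real_inner set"
  assumes compl: "complete S" and conv: "ereal_convex_on S f"
    and proper: "proper_on S f" and lsc: "lsc_on S f"
  shows "\<exists>p\<in>S. \<forall>y\<in>S. f p + ereal (1 / 2 * (norm (p - w))\<^sup>2)
                    \<le> f y + ereal (1 / 2 * (norm (y - w))\<^sup>2)"
proof -
  define D where "D = {y \<in> S. f y \<noteq> \<infinity>}"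
  \<comment> \<open>Where \<open>f\<close> is infinite, \<open>g\<close> takes the default value 0,
    so \<open>g\<close> and \<open>h\<close> are only meaningful on the effective domain
    \<open>D\<close>.\<close>
  define g where "g y = real_of_ereal (f y)" for y
  have fg: "f y = ereal (g y)" if "y \<in> D" for y
    using that proper by (cases "f y") (auto simp: D_def g_def proper_on_def)
  have DS: "y \<in> S" if "y \<in> D" for y
    using that by (simp add: D_def)
  obtain y0 where y0: "y0 \<in> D"
    using proper by (auto simp: D_def proper_on_def)
  define h where "h y = g y + 1 / 2 * (norm (y - w))\<^sup>2" for y
  obtain b where b: "b \<ge> 0" "\<And>y. y \<in> D \<Longrightarrow> g y0 - 1 - b * norm (y - y0) \<le> g y"
    using convex_lsc_linear_lower_bound[OF conv lsc DS[OF y0] fg[OF y0]] fg DS by metis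
  \<comment> \<open>The quadratic term absorbs the linear growth: completing the square in
    \<open>norm (y - w)\<close> costs the constant \<open>b\<^sup>2 / 2\<close>.\<close>
  have lower: "g y0 - 1 - b * norm (w - y0) - b\<^sup>2 / 2 \<le> h y" if "y \<in> D" for y
  proof -
    have "norm (y - y0) \<le> norm (y - w) + norm (w - y0)"
      using norm_triangle_ineq[of "y - w" "w - y0"] by simp
    then have "b * norm (y - y0) \<le> b * (norm (y - w) + norm (w - y0))"
      using b(1) by (rule mult_left_mono)
    moreover have "0 \<le> (norm (y - w) - b)\<^sup>2"
      by simp
    ultimately show ?thesis
      using b(2)[OF that] by (simp add: h_def power2_eq_square algebra_simps)
  qed
  define m where "m = (INF y\<in>D. h y)"
  have bdd: "bdd_below (h ` D)"
    using lower by (intro bdd_belowI2)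
  have m: "m \<le> h y" if "y \<in> D" for y
    unfolding m_def using bdd that by (rule cINF_lower)
  have "\<exists>y\<in>D. h y < m + inverse (real (Suc n))" for n
    using cINF_less_iff[OF _ bdd, of "m + inverse (real (Suc n))"] y0
    unfolding m_def by auto
  then obtain Y where Y: "\<And>n. Y n \<in> D" "\<And>n. h (Y n) < m + inverse (real (Suc n))"
    by metis
  \<comment> \<open>The midpoint \<open>v\<close> is itself a competitor, so
    \<open>m \<le> h v\<close>. The average of the two values of \<open>h\<close> exceeds
    \<open>m\<close> by at most half the sum of the two tolerances, and this pays for
    \<open>1/8\<close> of the squared distance; hence the factor 4.\<close>
  have gap: "(norm (Y i - Y j))\<^sup>2 \<le> 4 * (inverse (real (Suc i)) + inverse (real (Suc j)))" for i j
  proof -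
    define v where "v = Y i + (1/2) *\<^sub>R (Y j - Y i)"
    have "f v \<le> ereal ((1 - 1/2) * g (Y i) + 1/2 * g (Y j))"
      using ereal_convex_onD[OF conv DS DS _ _ fg fg, of "Y i" "Y j" "1/2"] Y by (simp add: v_def)
    moreover have "v \<in> S"
      using conv convex_segment_mem[of S "Y i" "Y j" "1/2"] DS Y
      by (simp add: ereal_convex_on_def v_def)
    ultimately have v: "v \<in> D"
      by (auto simp: D_def)
    have "g v \<le> 1/2 * g (Y i) + 1/2 * g (Y j)"
      using \<open>f v \<le> _\<close> by (simp add: fg[OF v])
    have "m \<le> 1/2 * h (Y i) + 1/2 * h (Y j) - 1/8 * (norm (Y i - Y j))\<^sup>2"
      using m[OF v] \<open>g v \<le> _\<close> midpoint_norm_sq[of "Y i" "Y j" w, folded v_def]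
      unfolding h_def by argo
    then show ?thesis
      using Y(2)[of i] Y(2)[of j] by argo
  qed
  have "Cauchy Y"
  proof (rule CauchyI)
    fix e :: real
    assume "e > 0"
    then obtain M where M: "inverse (real (Suc M)) < e\<^sup>2 / 8"
      using reals_Archimedean[of "e\<^sup>2 / 8"] by auto
    have small: "inverse (real (Suc i)) < e\<^sup>2 / 8" if "i \<ge> M" for i
      by (rule le_less_trans[OF _ M]) (use that in \<open>auto intro: le_imp_inverse_le\<close>)
    have "norm (Y i - Y j) < e" if "i \<ge> M" "j \<ge> M" for i j
    proof -
      have "(norm (Y i - Y j))\<^sup>2 < e\<^sup>2"
        using gap[of i j] small[OF that(1)] small[OF that(2)] by argo
      then show ?thesis
        using \<open>e > 0\<close> by (simp add: power2_less_imp_less)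
    qed
    then show "\<exists>M. \<forall>i\<ge>M. \<forall>j\<ge>M. norm (Y i - Y j) < e"
      by blast
  qed
  then obtain l where l: "l \<in> S" "Y \<longlonglongrightarrow> l"
    using compl Y(1) DS unfolding complete_def by blast
  \<comment> \<open>A real threshold \<open>c\<close> stands in for \<open>f l\<close>, which is not
    yet known to be finite. Since \<open>c\<close> may be any real below \<open>f l\<close>, the
    bound afterwards passes to \<open>f l\<close> itself.\<close>
  have below: "c + 1 / 2 * (norm (l - w))\<^sup>2 \<le> m" if c: "ereal c < f l" for c
  proof -
    obtain r where r: "r > 0" "\<forall>y\<in>S. dist y l < r \<longrightarrow> ereal c < f y"
      using lsc_onD[OF lsc l(1) c] by blast
    have "\<forall>\<^sub>F n in sequentially. dist (Y n) l < r"
      using l(2) r(1) by (rule tendstoD)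
    then have ev: "\<forall>\<^sub>F n in sequentially.
        c + 1 / 2 * (norm (Y n - w))\<^sup>2 \<le> m + inverse (real (Suc n))"
    proof eventually_elim
      case (elim n)
      then have "c < g (Y n)"
        using r(2) Y(1)[of n] DS fg[OF Y(1)[of n]] by force
      then show ?case
        using Y(2)[of n] by (simp add: h_def)
    qed
    have "(\<lambda>n. c + 1 / 2 * (norm (Y n - w))\<^sup>2) \<longlonglongrightarrow> c + 1 / 2 * (norm (l - w))\<^sup>2"
      by (intro tendsto_intros l)
    moreover have "(\<lambda>n. m + inverse (real (Suc n))) \<longlonglongrightarrow> m + 0"
      by (intro tendsto_intros LIMSEQ_inverse_real_of_nat)
    ultimately show ?thesis
      using tendsto_le[OF _ _ _ ev] by auto
  qed
  have "f l \<le> ereal (m - 1 / 2 * (norm (l - w))\<^sup>2)"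
  proof (rule ccontr)
    assume "\<not> ?thesis"
    then obtain c where "ereal (m - 1 / 2 * (norm (l - w))\<^sup>2) < ereal c" "ereal c < f l"
      using ereal_dense2 by (metis not_le)
    then show False
      using below[of c] by simp
  qed
  then have fl: "f l + ereal (1 / 2 * (norm (l - w))\<^sup>2) \<le> ereal m"
    by (cases "f l") auto
  have "ereal m \<le> f y + ereal (1 / 2 * (norm (y - w))\<^sup>2)" if "y \<in> S" for y
  proof (cases "y \<in> D")
    case True
    then show ?thesis
      using m[of y] by (simp add: fg h_def)
  next
    case False
    then show ?thesis
      using that by (simp add: D_def)
  qed
  then show ?thesis
    using l(1) fl by (meson order_trans)
qed

section \<open>Optimality of the proximal point\<close>

text \<open>\<open>arg_min_on\<close> is a Hilbert choice, so it is informative only once some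
  minimizer is known to exist; every possible choice then has both properties.\<close>

lemma prox_minimizes:
  fixes S :: "'a::real_inner set"
  assumes "complete S" "ereal_convex_on S f" "proper_on S f" "lsc_on S f"
  shows "prox S f w \<in> S"
    and "\<And>y. y \<in> S \<Longrightarrow> f (prox S f w) + ereal (1 / 2 * (norm (prox S f w - w))\<^sup>2)
                    \<le> f y + ereal (1 / 2 * (norm (y - w))\<^sup>2)"
proof -
  let ?h = "\<lambda>y. f y + ereal (1 / 2 * (norm (y - w))\<^sup>2)"
  obtain p where "p \<in> S" "\<forall>y\<in>S. ?h p \<le> ?h y"
    using prox_objective_attains_min[OF assms] by blast
  then have "is_arg_min ?h (\<lambda>y. y \<in> S) p"
    by (auto simp: is_arg_min_def not_less)
  then have "is_arg_min ?h (\<lambda>y. y \<in> S) (prox S f w)"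
    unfolding prox_def arg_min_on_def arg_min_def by (rule someI)
  then show "prox S f w \<in> S"
    and "\<And>y. y \<in> S \<Longrightarrow> ?h (prox S f w) \<le> ?h y"
    by (auto simp: is_arg_min_def not_less)
qed

lemma prox_finite:
  fixes S :: "'a::real_inner set"
  assumes "complete S" "ereal_convex_on S f" "proper_on S f" "lsc_on S f"
  shows "\<bar>f (prox S f w)\<bar> \<noteq> \<infinity>"
proof -
  obtain y where "y \<in> S" "f y \<noteq> \<infinity>"
    using assms(3) by (auto simp: proper_on_def)
  then have "f (prox S f w) \<noteq> \<infinity>"
    using prox_minimizes(2)[OF assms \<open>y \<in> S\<close>, of w] by auto
  then show ?thesis
    using assms(3) prox_minimizes(1)[OF assms] by (auto simp: proper_on_def)
qed

text \<open>Minimality of \<open>p\<close> is tested at \<open>p + t *\<^sub>R (y - p)\<close>.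
  Convexity bounds \<open>f\<close> there, the expanded square contributes a linear term and a
  remainder of order \<open>t\<^sup>2\<close>, and dividing by \<open>t\<close> and letting it tend
  to 0 leaves the subgradient inequality.\<close>

lemma prox_subgradient:
  fixes S :: "'a::real_inner set"
  assumes "complete S" "ereal_convex_on S f" "proper_on S f" "lsc_on S f"
    and "subspace S" "w \<in> S"
  shows "w - prox S f w \<in> subdifferential S f (prox S f w)"
proof -
  define p where "p = prox S f w"
  have p: "p \<in> S" and min: "\<And>y. y \<in> S \<Longrightarrow>
      f p + ereal (1 / 2 * (norm (p - w))\<^sup>2) \<le> f y + ereal (1 / 2 * (norm (y - w))\<^sup>2)"
    using prox_minimizes[OF assms(1-4)] by (auto simp: p_def)
  obtain a where a: "f p = ereal a"
    using prox_finite[OF assms(1-4)] unfolding p_def by fastforce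
  have "f p + ereal ((w - p) \<bullet> (y - p)) \<le> f y" if y: "y \<in> S" for y
  proof (cases "f y")
    case (real c)
    have "a - c + (w - p) \<bullet> (y - p) \<le> t * ((norm (y - p))\<^sup>2 / 2)" if t: "0 < t" "t \<le> 1" for t
    proof -
      let ?v = "p + t *\<^sub>R (y - p)"
      have "?v \<in> S"
        using convex_segment_mem[OF subspace_imp_convex[OF assms(5)] p y] t by simp
      then have "ereal (a + 1 / 2 * (norm (p - w))\<^sup>2) \<le> f ?v + ereal (1 / 2 * (norm (?v - w))\<^sup>2)"
        using min[of ?v] a by simp
      also have "\<dots> \<le> ereal ((1 - t) * a + t * c) + ereal (1 / 2 * (norm (?v - w))\<^sup>2)"
        using ereal_convex_onD[OF assms(2) p y _ _ a real] t by (intro add_right_mono) simp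
      finally have "a + 1 / 2 * (norm (p - w))\<^sup>2
          \<le> (1 - t) * a + t * c + 1 / 2 * (norm (?v - w))\<^sup>2"
        by simp
      moreover have "(norm (?v - w))\<^sup>2
          = (norm (p - w))\<^sup>2 - 2 * t * ((w - p) \<bullet> (y - p)) + t\<^sup>2 * (norm (y - p))\<^sup>2"
      proof -
        have "?v - w = (p - w) + t *\<^sub>R (y - p)"
          by simp
        then have "(norm (?v - w))\<^sup>2 = (norm (p - w))\<^sup>2 + 2 * (t * ((p - w) \<bullet> (y - p)))
            + t\<^sup>2 * (norm (y - p))\<^sup>2"
          by (simp only: norm_add_sq) (simp add: power_mult_distrib)
        moreover have "(p - w) \<bullet> (y - p) = - ((w - p) \<bullet> (y - p))"
          by (metis inner_minus_left minus_diff_eq)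
        ultimately show ?thesis
          by simp
      qed
      ultimately have "t * (a - c + (w - p) \<bullet> (y - p)) \<le> t * (t * ((norm (y - p))\<^sup>2 / 2))"
        by (simp add: algebra_simps power2_eq_square)
      then show ?thesis
        using t by (simp only: mult_le_cancel_left_pos)
    qed
    then have "a - c + (w - p) \<bullet> (y - p) \<le> 0"
      by (rule nonpos_if_le_small_multiples)
    then show ?thesis
      using a real by simp
  next
    case MInf
    then show ?thesis
      using assms(3) y by (auto simp: proper_on_def)
  qed simp
  then show ?thesis
    using p assms(5,6) unfolding subdifferential_def p_def by (auto simp: subspace_diff)
qed

section \<open>Scaling by a positive step length\<close>

lemma ereal_convex_on_cmult:
  assumes "ereal_convex_on S f" "0 < \<tau>"
  shows "ereal_convex_on S (\<lambda>y. ereal \<tau> * f y)"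
  unfolding ereal_convex_on_def
proof (intro conjI ballI allI impI)
  show "convex S"
    using assms by (simp add: ereal_convex_on_def)
next
  fix x y and u v :: real
  assume *: "x \<in> S" "y \<in> S" "0 \<le> u" "0 \<le> v" "u + v = 1"
  then have "f (u *\<^sub>R x + v *\<^sub>R y) \<le> ereal u * f x + ereal v * f y"
    using assms by (simp add: ereal_convex_on_def)
  then have "ereal \<tau> * f (u *\<^sub>R x + v *\<^sub>R y) \<le> ereal \<tau> * (ereal u * f x + ereal v * f y)"
    using assms(2) by (intro ereal_mult_left_mono) auto
  also have "\<dots> = ereal u * (ereal \<tau> * f x) + ereal v * (ereal \<tau> * f y)"
    using assms(2) by (simp add: ereal_pos_distrib mult.left_commute)
  finally show "ereal \<tau> * f (u *\<^sub>R x + v *\<^sub>R y)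
      \<le> ereal u * (ereal \<tau> * f x) + ereal v * (ereal \<tau> * f y)" .
qed

lemma proper_on_cmult:
  assumes "proper_on S f" "0 < \<tau>"
  shows "proper_on S (\<lambda>y. ereal \<tau> * f y)"
  using assms unfolding proper_on_def by (auto simp: ereal_mult_eq_MInfty)

lemma lsc_on_cmult:
  assumes "lsc_on S f" "0 < \<tau>"
  shows "lsc_on S (\<lambda>y. ereal \<tau> * f y)"
  unfolding lsc_on_def le_Liminf_iff
proof (intro ballI allI impI)
  fix x c
  assume *: "x \<in> S" "c < ereal \<tau> * f x"
  \<comment> \<open>Multiplication by a positive real is an order isomorphism of the extended reals,
    so thresholds for the scaled function are rescaled thresholds for \<open>f\<close>.\<close>
  have iff: "c < ereal \<tau> * e \<longleftrightarrow> c / ereal \<tau> < e" for e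
    using assms(2) by (simp add: ereal_divide_less_iff mult.commute)
  show "\<forall>\<^sub>F y in at x within S. c < ereal \<tau> * f y"
    using assms(1) * unfolding iff lsc_on_def le_Liminf_iff by blast
qed

text \<open>The proximal step yields a subgradient of \<tau> times \<open>G\<close>, whereas the
  factor of strong subdifferentiability belongs to \<open>G\<close>; this passes from one to the
  other.\<close>

lemma subdifferential_cmult:
  assumes "q \<in> subdifferential S (\<lambda>y. ereal \<tau> * f y) p" "0 < \<tau>" "subspace S"
  shows "(1 / \<tau>) *\<^sub>R q \<in> subdifferential S f p"
  unfolding subdifferential_def
proof (intro CollectI conjI ballI)
  show "(1 / \<tau>) *\<^sub>R q \<in> S"
    using assms by (simp add: subdifferential_def subspace_scale)
next
  fix y
  assume "y \<in> S"
  then have "ereal \<tau> * f p + ereal (q \<bullet> (y - p)) \<le> ereal \<tau> * f y"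
    using assms(1) by (simp add: subdifferential_def)
  then show "f p + ereal ((1 / \<tau>) *\<^sub>R q \<bullet> (y - p)) \<le> f y"
    using assms(2) by (cases "f p"; cases "f y") (auto simp: field_simps)
qed

section \<open>Gradient inequalities\<close>

text \<open>The chain rule along a segment reduces gradient inequalities to one real variable. The
  derivative is taken within \<open>{0..1}\<close> since differentiability is given only within
  \<open>S\<close>.\<close>

lemma gradient_segment_derivative:
  assumes "has_gradient_on f g S" "convex S" "x \<in> S" "y \<in> S" "t \<in> {0..1}"
  shows "((\<lambda>t. f (x + t *\<^sub>R (y - x))) has_derivative
           (\<lambda>s. s * (g (x + t *\<^sub>R (y - x)) \<bullet> (y - x)))) (at t within {0..1})"
proof -
  let ?c = "\<lambda>t. x + t *\<^sub>R (y - x)"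
  have c: "?c ` {0..1} \<subseteq> S"
    using convex_segment_mem[OF assms(2-4)] by auto
  then have "(f has_derivative (\<lambda>h. g (?c t) \<bullet> h)) (at (?c t) within ?c ` {0..1})"
    using assms(1,5) unfolding has_gradient_on_def by (meson has_derivative_subset image_subset_iff)
  moreover have "(?c has_derivative (\<lambda>s. s *\<^sub>R (y - x))) (at t within {0..1})"
    by (auto intro!: derivative_eq_intros)
  ultimately have "(f \<circ> ?c has_derivative (\<lambda>h. g (?c t) \<bullet> h) \<circ> (\<lambda>s. s *\<^sub>R (y - x)))
      (at t within {0..1})"
    by (intro diff_chain_within)
  then show ?thesis
    by (simp add: o_def)
qed

text \<open>By convexity the difference quotients on the segment from \<open>x\<close> to
  \<open>y\<close> are at most \<open>f y - f x\<close>; their limit at 0 from the right is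
  \<open>g x \<bullet> (y - x)\<close>.\<close>

lemma gradient_in_subdifferential:
  assumes grad: "has_gradient_on f g S" and conv: "ereal_convex_on S (\<lambda>y. ereal (f y))"
    and x: "x \<in> S"
  shows "g x \<in> subdifferential S (\<lambda>y. ereal (f y)) x"
  unfolding subdifferential_def
proof (intro CollectI conjI ballI)
  show "g x \<in> S"
    using grad x by (simp add: has_gradient_on_def)
next
  fix y
  assume y: "y \<in> S"
  have convS: "convex S"
    using conv by (simp add: ereal_convex_on_def)
  let ?\<phi> = "\<lambda>t. f (x + t *\<^sub>R (y - x))"
  have "(?\<phi> has_field_derivative (g x \<bullet> (y - x))) (at 0 within {0..1})"
    using gradient_segment_derivative[OF grad convS x y, of 0]
    by (simp add: has_field_derivative_def mult.commute[of _ "g x \<bullet> (y - x)"])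
  then have lim: "((\<lambda>t. (?\<phi> t - f x) / t) \<longlongrightarrow> g x \<bullet> (y - x)) (at_right 0)"
    by (simp add: has_field_derivative_iff at_within_Icc_at_right)
  have "\<forall>\<^sub>F t in at_right (0::real). t \<in> {0<..<1}"
    by (rule eventually_at_right_real) simp
  then have "\<forall>\<^sub>F t in at_right (0::real). (?\<phi> t - f x) / t \<le> f y - f x"
  proof eventually_elim
    case (elim t)
    then have "?\<phi> t \<le> (1 - t) * f x + t * f y"
      using ereal_convex_onD[OF conv x y, of t] by simp
    then show ?case
      using elim by (simp add: field_simps)
  qed
  then have "g x \<bullet> (y - x) \<le> f y - f x"
    by (rule tendsto_upperbound[OF lim]) simp
  then show "ereal (f x) + ereal (g x \<bullet> (y - x)) \<le> ereal (f y)"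
    by simp
qed

lemma descent_lemma:
  assumes grad: "has_gradient_on f g S" and convS: "convex S"
    and lip: "L-lipschitz_on S g" and x: "x \<in> S" and y: "y \<in> S"
  shows "f y \<le> f x + g x \<bullet> (y - x) + L / 2 * (norm (y - x))\<^sup>2"
proof -
  let ?c = "\<lambda>t. x + t *\<^sub>R (y - x)"
  define a b where "a = g x \<bullet> (y - x)" and "b = L / 2 * (norm (y - x))\<^sup>2"
  \<comment> \<open>The mean value theorem takes the place of integrating the gradient. The
    Lipschitz bound on the increment of the gradient is exactly \<open>2 * t * b\<close>, so the
    derivative of \<open>?\<psi>\<close> is nonpositive, and
    \<open>?\<psi> 1 \<le> ?\<psi> 0\<close> is the claim.\<close>
  let ?\<psi> = "\<lambda>t. f (?c t) - (t * a + t\<^sup>2 * b)"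
  have der: "(?\<psi> has_derivative (\<lambda>s. s * (g (?c t) \<bullet> (y - x)) - s * (a + 2 * t * b)))
      (at t within {0..1})" if "0 \<le> t" "t \<le> 1" for t
  proof (rule has_derivative_diff)
    show "((\<lambda>t. f (?c t)) has_derivative (\<lambda>s. s * (g (?c t) \<bullet> (y - x)))) (at t within {0..1})"
      using gradient_segment_derivative[OF grad convS x y, of t] that by simp
    show "((\<lambda>t. t * a + t\<^sup>2 * b) has_derivative (\<lambda>s. s * (a + 2 * t * b))) (at t within {0..1})"
      by (rule derivative_eq_intros refl | simp add: algebra_simps)+
  qed
  obtain t where t: "t \<in> {0..1}" "?\<psi> 1 - ?\<psi> 0 = g (?c t) \<bullet> (y - x) - (a + 2 * t * b)"
    using mvt_very_simple[OF zero_le_one der] by auto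
  have "(g (?c t) - g x) \<bullet> (y - x) \<le> norm (g (?c t) - g x) * norm (y - x)"
    by (rule norm_cauchy_schwarz)
  also have "\<dots> \<le> (L * norm (?c t - x)) * norm (y - x)"
    using lipschitz_onD[OF lip convex_segment_mem[OF convS x y] x, of t] t(1)
    by (intro mult_right_mono) (auto simp: dist_norm)
  also have "\<dots> = t * L * (norm (y - x))\<^sup>2"
    using t(1) by (simp add: power2_eq_square)
  finally show ?thesis
    using t(2) by (simp add: inner_diff_left a_def b_def)
qed

section \<open>The estimate for one forward-backward step\<close>

lemma real_subdifferentiable_with_factorD:
  assumes "subdifferentiable_with_factor S (\<lambda>y. ereal (f y)) \<gamma>"
    and "q \<in> subdifferential S (\<lambda>y. ereal (f y)) x" "x \<in> S" "y \<in> S"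
  shows "f x + (q \<bullet> (y - x) + \<gamma> / 2 * (norm (y - x))\<^sup>2) \<le> f y"
  using assms unfolding subdifferentiable_with_factor_def
  by (metis ereal_less_eq(3) plus_ereal.simps(1))

text \<open>The gradient is evaluated at \<open>z\<close>, but the gap is between \<open>p\<close>
  and \<open>u\<close>. If \<open>\<gamma>F > 0\<close>, strong subdifferentiability is used at
  \<open>p\<close> and the change of gradient from \<open>z\<close> to \<open>p\<close> is paid for.
  If \<open>\<gamma>F = 0\<close>, convexity is used at \<open>z\<close>, followed by the descent
  lemma from \<open>z\<close> to \<open>p\<close>.\<close>

lemma three_point_gradient_bound:
  fixes S :: "'a::real_inner set"
  assumes conv: "ereal_convex_on S (\<lambda>y. ereal (F y))"
    and grad: "has_gradient_on F gF S" and lip: "L-lipschitz_on S gF"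
    and factor: "subdifferentiable_with_factor S (\<lambda>y. ereal (F y)) \<gamma>F"
    and "0 < \<tau>" "0 < \<zeta>" and step: "\<gamma>F = 0 \<Longrightarrow> \<tau> * L \<le> \<zeta>"
    and mem: "z \<in> S" "p \<in> S" "u \<in> S"
  shows "F p - F u \<le> gF z \<bullet> (p - u) + \<zeta> / (2 * \<tau>) * (norm (p - z))\<^sup>2
    - (if \<gamma>F > 0 then \<gamma>F - \<tau> * inverse \<zeta> * L\<^sup>2 else 0) / 2 * (norm (p - u))\<^sup>2"
proof (cases "\<gamma>F > 0")
  case True
  have "F p + (gF p \<bullet> (u - p) + \<gamma>F / 2 * (norm (u - p))\<^sup>2) \<le> F u"
    using real_subdifferentiable_with_factorD[OF factor
        gradient_in_subdifferential[OF grad conv] _ mem(3)] mem by blast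
  moreover have "(gF p - gF z) \<bullet> (p - u)
      \<le> \<zeta> / (2 * \<tau>) * (norm (p - z))\<^sup>2 + \<tau> * L\<^sup>2 / (2 * \<zeta>) * (norm (p - u))\<^sup>2"
  proof -
    have "(gF p - gF z) \<bullet> (p - u) \<le> norm (gF p - gF z) * norm (p - u)"
      by (rule norm_cauchy_schwarz)
    also have "\<dots> \<le> (L * norm (p - z)) * norm (p - u)"
      using lipschitz_onD[OF lip mem(2,1)] by (intro mult_right_mono) (auto simp: dist_norm)
    also have "\<dots> \<le> \<zeta> / (2 * \<tau>) * (norm (p - z))\<^sup>2 + \<tau> * L\<^sup>2 / (2 * \<zeta>) * (norm (p - u))\<^sup>2"
    proof -
      \<comment> \<open>Young's inequality, weighted so that \<open>(norm (p - z))\<^sup>2\<close>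
        receives exactly \<zeta>/(2\<tau>); the matching weight of
        \<open>(norm (p - u))\<^sup>2\<close> is the loss subtracted from
        \<open>\<gamma>F\<close>.\<close>
      have "0 \<le> (\<zeta> * norm (p - z) - \<tau> * L * norm (p - u))\<^sup>2 / (2 * \<tau> * \<zeta>)"
        using assms by simp
      also have "\<dots> = \<zeta> / (2 * \<tau>) * (norm (p - z))\<^sup>2 + \<tau> * L\<^sup>2 / (2 * \<zeta>) * (norm (p - u))\<^sup>2
          - (L * norm (p - z)) * norm (p - u)"
        using assms(5,6) by (simp add: field_simps power2_eq_square)
      finally show ?thesis
        by simp
    qed
    finally show ?thesis .
  qed
  moreover have "gF p \<bullet> (u - p) = - (gF p \<bullet> (p - u))"
    by (simp add: inner_diff_right)
  ultimately have "F p - F u \<le> gF z \<bullet> (p - u) + \<zeta> / (2 * \<tau>) * (norm (p - z))\<^sup>2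
      + \<tau> * L\<^sup>2 / (2 * \<zeta>) * (norm (p - u))\<^sup>2 - \<gamma>F / 2 * (norm (p - u))\<^sup>2"
    by (simp add: inner_diff_left norm_minus_commute)
  also have "\<dots> = gF z \<bullet> (p - u) + \<zeta> / (2 * \<tau>) * (norm (p - z))\<^sup>2
      - (\<gamma>F - \<tau> * inverse \<zeta> * L\<^sup>2) / 2 * (norm (p - u))\<^sup>2"
    using assms(6) by (simp add: field_simps)
  finally show ?thesis
    using True by simp
next
  case False
  then have "\<gamma>F = 0"
    using factor by (simp add: subdifferentiable_with_factor_def)
  have "F z + gF z \<bullet> (u - z) \<le> F u"
    using real_subdifferentiable_with_factorD[OF factor
        gradient_in_subdifferential[OF grad conv] _ mem(3)] mem \<open>\<gamma>F = 0\<close> by force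
  moreover have "F p \<le> F z + gF z \<bullet> (p - z) + L / 2 * (norm (p - z))\<^sup>2"
    using descent_lemma[OF grad _ lip mem(1,2)] conv by (simp add: ereal_convex_on_def)
  moreover have "L / 2 * (norm (p - z))\<^sup>2 \<le> \<zeta> / (2 * \<tau>) * (norm (p - z))\<^sup>2"
    using step[OF \<open>\<gamma>F = 0\<close>] assms(5) by (intro mult_right_mono) (auto simp: field_simps)
  ultimately show ?thesis
    using False by (simp add: inner_diff_right)
qed

text \<open>When the bounds for \<open>F\<close> and \<open>G\<close> are added, the terms
  \<open>gF z \<bullet> (p - u)\<close> cancel. The remaining product
  \<open>(z - p) \<bullet> (p - u)\<close> splits into three squared distances; of its 1/(2\<tau>)
  share of \<open>(norm (p - z))\<^sup>2\<close>, the bound for \<open>F\<close> uses up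
  \<zeta>/(2\<tau>).\<close>

lemma forward_backward_step:
  fixes S :: "'a::real_inner set"
  assumes S: "subspace S" "complete S"
    and F: "ereal_convex_on S (\<lambda>y. ereal (F y))" "has_gradient_on F gF S" "L-lipschitz_on S gF"
      "subdifferentiable_with_factor S (\<lambda>y. ereal (F y)) \<gamma>F"
    and G: "ereal_convex_on S G" "proper_on S G" "lsc_on S G" "subdifferentiable_with_factor S G \<gamma>G"
    and \<tau>: "0 < \<tau>" and \<zeta>: "0 < \<zeta>" and step: "\<gamma>F = 0 \<Longrightarrow> \<tau> * L \<le> \<zeta>"
    and \<gamma>: "\<gamma> = (if \<gamma>F > 0 then \<gamma>G + \<gamma>F - \<tau> * inverse \<zeta> * L\<^sup>2 else \<gamma>G)"
    and mem: "z \<in> S" "u \<in> S"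
    and p: "p = prox S (\<lambda>y. ereal \<tau> * G y) (z - \<tau> *\<^sub>R gF z)"
  shows "p \<in> S"
    and "objective F G p - objective F G u
      \<le> ereal ((norm (z - u))\<^sup>2 / (2 * \<tau>) - (1 + \<gamma> * \<tau>) / (2 * \<tau>) * (norm (p - u))\<^sup>2
                - (1 - \<zeta>) / (2 * \<tau>) * (norm (p - z))\<^sup>2)"
proof -
  note \<tau>G = S(2) ereal_convex_on_cmult[OF G(1) \<tau>] proper_on_cmult[OF G(2) \<tau>] lsc_on_cmult[OF G(3) \<tau>]
  show pS: "p \<in> S"
    unfolding p using prox_minimizes(1)[OF \<tau>G] .
  have "\<bar>ereal \<tau> * G p\<bar> \<noteq> \<infinity>"
    unfolding p using prox_finite[OF \<tau>G] .
  then obtain a where a: "G p = ereal a"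
    using \<tau> by (cases "G p") auto
  have "gF z \<in> S"
    using F(2) mem by (simp add: has_gradient_on_def)
  then have "z - \<tau> *\<^sub>R gF z - p \<in> subdifferential S (\<lambda>y. ereal \<tau> * G y) p"
    unfolding p using prox_subgradient[OF \<tau>G S(1)] S(1) mem by (simp add: subspace_diff subspace_scale)
  then have q: "(1 / \<tau>) *\<^sub>R (z - \<tau> *\<^sub>R gF z - p) \<in> subdifferential S G p"
    using subdifferential_cmult \<tau> S(1) by blast
  show "objective F G p - objective F G u
      \<le> ereal ((norm (z - u))\<^sup>2 / (2 * \<tau>) - (1 + \<gamma> * \<tau>) / (2 * \<tau>) * (norm (p - u))\<^sup>2
                - (1 - \<zeta>) / (2 * \<tau>) * (norm (p - z))\<^sup>2)"
  proof (cases "G u")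
    case (real c)
    have "G p + ereal ((1 / \<tau>) *\<^sub>R (z - \<tau> *\<^sub>R gF z - p) \<bullet> (u - p) + \<gamma>G / 2 * (norm (u - p))\<^sup>2) \<le> G u"
      using G(4) q pS mem(2) unfolding subdifferentiable_with_factor_def by blast
    then have G_ineq: "a - c \<le> ((z - p) \<bullet> (p - u)) / \<tau> - gF z \<bullet> (p - u) - \<gamma>G / 2 * (norm (p - u))\<^sup>2"
    proof -
      have "(1 / \<tau>) *\<^sub>R (z - \<tau> *\<^sub>R gF z - p) \<bullet> (u - p)
          = gF z \<bullet> (p - u) - ((z - p) \<bullet> (p - u)) / \<tau>"
        using \<tau> by (simp add: inner_simps field_simps)
      then show ?thesis
        using \<open>G p + _ \<le> G u\<close> by (simp add: a real norm_minus_commute)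
    qed
    \<comment> \<open>The difference \<open>\<gamma> - \<gamma>G\<close> is the conditional
      expression of the gradient bound, so both cases are covered at once.\<close>
    have F_ineq: "F p - F u \<le> gF z \<bullet> (p - u) + \<zeta> / (2 * \<tau>) * (norm (p - z))\<^sup>2
        - (\<gamma> - \<gamma>G) / 2 * (norm (p - u))\<^sup>2"
      using three_point_gradient_bound[OF F \<tau> \<zeta> step mem(1) pS mem(2)] \<gamma>
      by (auto split: if_splits)
    have "(norm (z - u))\<^sup>2 = (norm (p - z))\<^sup>2 + 2 * ((z - p) \<bullet> (p - u)) + (norm (p - u))\<^sup>2"
      using norm_add_sq[of "z - p" "p - u"] by (simp add: norm_minus_commute)
    then have "((z - p) \<bullet> (p - u)) / \<tau>
        = ((norm (z - u))\<^sup>2 - (norm (p - z))\<^sup>2 - (norm (p - u))\<^sup>2) / (2 * \<tau>)"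
      using \<tau> by (simp add: field_simps)
    then have "(F p + a) - (F u + c)
        \<le> ((norm (z - u))\<^sup>2 - (norm (p - z))\<^sup>2 - (norm (p - u))\<^sup>2) / (2 * \<tau>)
          + \<zeta> / (2 * \<tau>) * (norm (p - z))\<^sup>2 - \<gamma> / 2 * (norm (p - u))\<^sup>2"
      using F_ineq G_ineq by (simp add: field_simps)
    also have "\<dots> = (norm (z - u))\<^sup>2 / (2 * \<tau>) - (1 + \<gamma> * \<tau>) / (2 * \<tau>) * (norm (p - u))\<^sup>2
                - (1 - \<zeta>) / (2 * \<tau>) * (norm (p - z))\<^sup>2"
      using \<tau> by (simp add: field_simps)
    finally show ?thesis
      by (simp add: objective_def a real)
  next
    \<comment> \<open>A comparison point of infinite cost makes the gap equal to
      \<open>-\<infinity>\<close>.\<close>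
    case PInf
    then show ?thesis
      by (simp add: objective_def a)
  next
    case MInf
    then show ?thesis
      using G(2) mem(2) by (auto simp: proper_on_def)
  qed
qed

section \<open>The regret bound\<close>

theorem corollary2p6:
  fixes X :: "nat \<Rightarrow> 'a::real_inner set"
    and F :: "nat \<Rightarrow> 'a \<Rightarrow> real"
    and G :: "nat \<Rightarrow> 'a \<Rightarrow> ereal"
    and gradF :: "nat \<Rightarrow> 'a \<Rightarrow> 'a"
    and A :: "nat \<Rightarrow> 'a \<Rightarrow> 'a"
    and B :: "(nat \<Rightarrow> 'a) set"
    and L \<gamma>F \<gamma>G \<gamma> \<zeta> \<Lambda> \<epsilon> :: "nat \<Rightarrow> real"
    and \<tau> :: real
    and N :: nat
    and x z :: "nat \<Rightarrow> 'a"
  assumes N: "N \<ge> 1"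
    and hilbert: "\<And>k. hilbert_subspace (X k)"
    and F_convex: "\<And>k. k \<ge> 1 \<Longrightarrow> ereal_convex_on (X k) (\<lambda>y. ereal (F k y))"
    and F_proper: "\<And>k. k \<ge> 1 \<Longrightarrow> proper_on (X k) (\<lambda>y. ereal (F k y))"
    and F_lsc: "\<And>k. k \<ge> 1 \<Longrightarrow> lsc_on (X k) (\<lambda>y. ereal (F k y))"
    and G_convex: "\<And>k. k \<ge> 1 \<Longrightarrow> ereal_convex_on (X k) (G k)"
    and G_proper: "\<And>k. k \<ge> 1 \<Longrightarrow> proper_on (X k) (G k)"
    and G_lsc: "\<And>k. k \<ge> 1 \<Longrightarrow> lsc_on (X k) (G k)"
    and gradient: "\<And>k. k \<ge> 1 \<Longrightarrow> has_gradient_on (F k) (gradF k) (X k)"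
    and gradient_lipschitz: "\<And>k. k \<ge> 1 \<Longrightarrow> (L k)-lipschitz_on (X k) (gradF k)"
    and F_factor: "\<And>k. k \<ge> 1 \<Longrightarrow>
          subdifferentiable_with_factor (X k) (\<lambda>y. ereal (F k y)) (\<gamma>F k)"
    and G_factor: "\<And>k. k \<ge> 1 \<Longrightarrow> subdifferentiable_with_factor (X k) (G k) (\<gamma>G k)"
    and tau: "\<tau> > 0"
    and zeta: "\<And>k. k \<ge> 1 \<Longrightarrow> 0 < \<zeta> k \<and> \<zeta> k \<le> 1"
    and gamma: "\<And>k. k \<ge> 1 \<Longrightarrow>
          \<gamma> k = (if \<gamma>F k > 0 then \<gamma>G k + \<gamma>F k - \<tau> * inverse (\<zeta> k) * (L k)\<^sup>2 else \<gamma>G k)"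
    and gamma_nonneg: "\<And>k. 0 \<le> \<gamma> k"
    and step_bound: "\<And>k. k \<ge> 1 \<Longrightarrow> \<gamma>F k = 0 \<Longrightarrow> \<tau> * L k \<le> \<zeta> k"
    and predictor: "\<And>k. A k \<in> X k \<rightarrow> X (Suc k)"
    and comparison: "B \<subseteq> Pi UNIV X"
    and comparison_bounded: "\<And>k. bounded (entries B k)"
    and Lambda: "\<And>k. \<Lambda> k > 0"
    and prediction: "\<And>xbar k. xbar \<in> B \<Longrightarrow>
          1 / 2 * (norm (A k (x k) - xbar (Suc k)))\<^sup>2
            \<le> \<Lambda> k / 2 * (norm (x k - xbar k))\<^sup>2 + \<epsilon> (Suc k)"
    and growth: "\<And>k. k < N \<Longrightarrow> 1 + \<gamma> k * \<tau> \<ge> \<Lambda> k"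
    and initial: "x 0 \<in> X 0"
    and predict_step: "\<And>k. z (Suc k) = A k (x k)"
    and prox_step: "\<And>k. x (Suc k) =
          prox (X (Suc k)) (\<lambda>y. ereal \<tau> * G (Suc k) y)
            (z (Suc k) - \<tau> *\<^sub>R gradF (Suc k) (z (Suc k)))"
  shows "(SUP xbar\<in>segments B 1 N.
            \<Sum>k=1..N. objective (F k) (G k) (x k) - objective (F k) (G k) (xbar k))
          + ereal (\<Sum>k<N. (1 - \<zeta> (Suc k)) / (2 * \<tau>) * (norm (x (Suc k) - A k (x k)))\<^sup>2)
        \<le> (SUP xbar0\<in>entries B 0.
            ereal ((norm (x 0 - xbar0))\<^sup>2 / (2 * \<tau> * inverse (1 + \<gamma> 0 * \<tau>))))
          + ereal (\<Sum>k=1..N. \<epsilon> k / \<tau>)"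
proof (cases "B = {}")
  \<comment> \<open>Both suprema are over the empty set, hence \<open>-\<infinity>\<close>, and
    adding a real number does not change this.\<close>
  case True
  then show ?thesis
    by (simp add: segments_def entries_def bot_ereal_def)
next
  case False
  \<comment> \<open>At index 0 this weight is the reciprocal of the denominator in the claimed
    bound.\<close>
  let ?w = "\<lambda>k. (1 + \<gamma> k * \<tau>) / (2 * \<tau>)"
  let ?e = "\<lambda>k. (1 - \<zeta> (Suc k)) / (2 * \<tau>) * (norm (x (Suc k) - A k (x k)))\<^sup>2"
  have sub: "subspace (X k)" "complete (X k)" for k
    using hilbert[of k] by (auto simp: hilbert_subspace_def)
  \<comment> \<open>Everything is stated under \<open>x k \<in> X k\<close>, so that the first part
    serves as the induction step for \<open>x_mem\<close>.\<close>
  have step: "x (Suc k) \<in> X (Suc k)"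
    "u \<in> X (Suc k) \<Longrightarrow>
      objective (F (Suc k)) (G (Suc k)) (x (Suc k)) - objective (F (Suc k)) (G (Suc k)) u
      \<le> ereal ((norm (A k (x k) - u))\<^sup>2 / (2 * \<tau>) - ?w (Suc k) * (norm (x (Suc k) - u))\<^sup>2 - ?e k)"
    if "x k \<in> X k" for k u
  proof -
    have k: "Suc k \<ge> 1"
      by simp
    have z: "A k (x k) \<in> X (Suc k)"
      using predictor that by auto
    note fb = forward_backward_step[OF sub F_convex[OF k] gradient[OF k] gradient_lipschitz[OF k]
        F_factor[OF k] G_convex[OF k] G_proper[OF k] G_lsc[OF k] G_factor[OF k] tau
        conjunct1[OF zeta[OF k]] step_bound[OF k] gamma[OF k] z _ prox_step[unfolded predict_step]]
    show "x (Suc k) \<in> X (Suc k)"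
      using fb(1)[OF _ z] by blast
    show "objective (F (Suc k)) (G (Suc k)) (x (Suc k)) - objective (F (Suc k)) (G (Suc k)) u
        \<le> ereal ((norm (A k (x k) - u))\<^sup>2 / (2 * \<tau>) - ?w (Suc k) * (norm (x (Suc k) - u))\<^sup>2 - ?e k)"
      if "u \<in> X (Suc k)"
      using fb(2) that by blast
  qed
  have x_mem: "x k \<in> X k" for k
    by (induction k) (use initial step(1) in auto)
  let ?R = "SUP xbar0\<in>entries B 0. ereal ((norm (x 0 - xbar0))\<^sup>2 / (2 * \<tau> * inverse (1 + \<gamma> 0 * \<tau>)))"
  have regret: "(\<Sum>k=1..N. objective (F k) (G k) (x k) - objective (F k) (G k) (xb k)) + ereal (\<Sum>k<N. ?e k)
      \<le> ?R + ereal (\<Sum>k=1..N. \<epsilon> k / \<tau>)" if xb: "xb \<in> B" for xb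
  proof -
    let ?d = "\<lambda>k. ?w k * (norm (x k - xb k))\<^sup>2"
    have "objective (F (Suc k)) (G (Suc k)) (x (Suc k)) - objective (F (Suc k)) (G (Suc k)) (xb (Suc k))
        \<le> ereal (?d k - ?d (Suc k) + \<epsilon> (Suc k) / \<tau> - ?e k)" if "k < N" for k
    proof -
      have "xb (Suc k) \<in> X (Suc k)"
        using comparison xb by auto
      note step(2)[OF x_mem this]
      \<comment> \<open>The distance from the prediction to entry \<open>Suc k\<close> is traded for
        that from \<open>x k\<close> to entry \<open>k\<close>, with the weight left by the
        preceding step; this makes the sum telescope.\<close>
      also have "(norm (A k (x k) - xb (Suc k)))\<^sup>2 / (2 * \<tau>) \<le> ?d k + \<epsilon> (Suc k) / \<tau>"
      proof -
        have "\<Lambda> k * (norm (x k - xb k))\<^sup>2 \<le> (1 + \<gamma> k * \<tau>) * (norm (x k - xb k))\<^sup>2"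
          using growth[OF that] by (intro mult_right_mono) auto
        then have "(norm (A k (x k) - xb (Suc k)))\<^sup>2
            \<le> (1 + \<gamma> k * \<tau>) * (norm (x k - xb k))\<^sup>2 + 2 * \<epsilon> (Suc k)"
          using prediction[OF xb, of k] by linarith
        then have "(norm (A k (x k) - xb (Suc k)))\<^sup>2 / (2 * \<tau>)
            \<le> ((1 + \<gamma> k * \<tau>) * (norm (x k - xb k))\<^sup>2 + 2 * \<epsilon> (Suc k)) / (2 * \<tau>)"
          using tau by (intro divide_right_mono) auto
        also have "\<dots> = ?d k + \<epsilon> (Suc k) / \<tau>"
          using tau by (simp add: field_simps)
        finally show ?thesis .
      qed
      finally show ?thesis
        by (simp add: algebra_simps)
    qed
    then have "(\<Sum>k<N. objective (F (Suc k)) (G (Suc k)) (x (Suc k))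
          - objective (F (Suc k)) (G (Suc k)) (xb (Suc k)))
        \<le> (\<Sum>k<N. ereal (?d k - ?d (Suc k) + \<epsilon> (Suc k) / \<tau> - ?e k))"
      by (intro sum_mono) simp
    also have "\<dots> = ereal (?d 0 - ?d N + (\<Sum>k<N. \<epsilon> (Suc k) / \<tau>) - (\<Sum>k<N. ?e k))"
      unfolding sum_ereal sum.distrib sum_subtractf sum_lessThan_telescope'[of ?d, symmetric] ..
    \<comment> \<open>The final weighted distance \<open>?d N\<close> is nonnegative and is
      dropped.\<close>
    also have "\<dots> \<le> ereal (?d 0 + (\<Sum>k<N. \<epsilon> (Suc k) / \<tau>) - (\<Sum>k<N. ?e k))"
      using gamma_nonneg[of N] tau by simp
    finally have "(\<Sum>k<N. objective (F (Suc k)) (G (Suc k)) (x (Suc k))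
          - objective (F (Suc k)) (G (Suc k)) (xb (Suc k))) + ereal (\<Sum>k<N. ?e k)
        \<le> ereal (?d 0 + (\<Sum>k<N. \<epsilon> (Suc k) / \<tau>) - (\<Sum>k<N. ?e k)) + ereal (\<Sum>k<N. ?e k)"
      by (rule add_right_mono)
    also have "\<dots> = ereal (?d 0) + ereal (\<Sum>k<N. \<epsilon> (Suc k) / \<tau>)"
      by simp
    \<comment> \<open>The entry \<open>xb 0\<close> is one of the competitors in the supremum,
      although the regret itself only involves entries from 1 on.\<close>
    also have "ereal (?d 0) \<le> ?R"
      using xb by (intro SUP_upper2[of "xb 0"]) (auto simp: entries_def field_simps)
    finally show ?thesis
      unfolding One_nat_def sum.atLeast_Suc_atMost_Suc_shift lessThan_atLeast0 atLeastLessThanSuc_atLeastAtMost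
      by (simp add: add_right_mono sum.atLeast1_atMost_eq atLeast0LessThan)
  qed
  \<comment> \<open>A real constant moves into a supremum over a nonempty set; over the empty set
    the two sides would also have to be compared as \<open>-\<infinity>\<close>, which is the case
    treated first.\<close>
  have "(SUP xb\<in>segments B 1 N.
          \<Sum>k=1..N. objective (F k) (G k) (x k) - objective (F k) (G k) (xb k)) + ereal (\<Sum>k<N. ?e k)
      = (SUP xb\<in>segments B 1 N.
          (\<Sum>k=1..N. objective (F k) (G k) (x k) - objective (F k) (G k) (xb k)) + ereal (\<Sum>k<N. ?e k))"
    using False by (intro SUP_ereal_add_left[symmetric]) (auto simp: segments_def)
  also have "\<dots> \<le> ?R + ereal (\<Sum>k=1..N. \<epsilon> k / \<tau>)"
    \<comment> \<open>A segment agrees with some member of \<open>B\<close> on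
      \<open>{1..N}\<close>, and the sum reads only these indices.\<close>
    by (rule SUP_least) (use regret in \<open>auto simp: segments_def\<close>)
  finally show ?thesis .
qed

end
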